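(* For each of the following two-dimensional complex associative trialgebras $\mathcal{T}=\mathrm{Trias}_2^m$, $1\le m\le 8$, the centroid $\Gamma(\mathcal{T})$ consists exactly of the linear maps whose matrix in the basis $\{e_1,e_2\}$ is $$\begin{pmatrix} a_{11}&0\\0&a_{11}\end{pmatrix},\qquad a_{11}\in\mathbb{C},$$ and hence has dimension $1$. Here (products of basis vectors not listed are zero; $a,b$ are scalar parameters): $\mathrm{Trias}_2^1$: $e_1\dashv e_2=ae_1,\ e_2\dashv e_2=ae_2;\quad e_2\vdash e_1=ae_1,\ e_2\vdash e_2=ae_2;\quad e_1\bot e_1=be_1,\ e_1\bot e_2=be_1+ae_2.$ $\mathrm{Trias}_2^2$: $e_1\dashv e_1=e_1,\ e_2\dashv e_1=e_2;\quad e_1\vdash e_1=e_1,\ e_1\vdash e_2=e_2;\quad e_1\bot e_2=e_1+ae_2,\ e_2\bot e_2=e_2.$ $\mathrm{Trias}_2^3$: $e_2\dashv e_2=e_2;\quad e_2\vdash e_1=e_1,\ e_2\vdash e_2=e_2;\quad e_2\bot e_1=e_1,\ e_2\bot e_2=e_2.$ $\mathrm{Trias}_2^4$: $e_1\dashv e_2=e_1,\ e_2\dashv e_2=e_2;\quad e_2\vdash e_2=e_1+e_2;\quad e_2\bot e_2=e_1+e_2.$ $\mathrm{Trias}_2^5$: $e_1\dashv e_1=e_1;\quad e_2\vdash e_1=e_1,\ e_2\vdash e_2=e_2;\quad e_1\bot e_1=e_1,\ e_1\bot e_2=e_2.$ $\mathrm{Trias}_2^6$: $e_1\dashv e_1=e_1,\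 e_2\dashv e_1=e_2;\quad e_1\vdash e_1=e_1;\quad e_1\bot e_1=e_1.$ $\mathrm{Trias}_2^7$: $e_1\dashv e_1=e_1,\ e_2\dashv e_1=e_2;\quad e_1\vdash e_1=e_1,\ e_1\vdash e_2=e_2;\quad e_1\bot e_1=e_1,\ e_1\bot e_2=e_2.$ $\mathrm{Trias}_2^8$: $e_1\dashv e_1=ae_1,\ e_2\dashv e_1=ae_2;\quad e_1\vdash e_1=ae_1,\ e_1\vdash e_2=ae_2;\quad e_1\bot e_1=ae_1+be_2.$
   Context: Each algebra is a vector space with basis $\{e_1,e_2\}$ and three bilinear products $\dashv,\vdash,\bot$. The centroid $\Gamma(\mathcal{T})$ is the space of linear maps $\psi:\mathcal{T}\to\mathcal{T}$ such that $\psi(x\bullet y)=x\bullet\psi(y)=\psi(x)\bullet y$ for all $x,y\in\mathcal{T}$ and each $\bullet\in\{\dashv,\vdash,\bot\}$.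
   Formalization: Parameters where the claim fails are excluded: (a,b) ≠ (0,0) for Trias_2^1 (otherwise the zero algebra) and a ≠ 0 for Trias_2^8 (otherwise e1↦e2, e2↦0 is in the centroid); the associative trialgebra axioms, which some tables violate, are not assumed. *)

theory Defs
  imports "HOL-Analysis.Analysis" "HOL-Library.Function_Algebras"
begin

text \<open>
  An algebra with three products: \<open>lprod\<close> is \<open>\<stileturn>\<close>, \<open>rprod\<close> is \<open>\<turnstile>\<close>, \<open>mprod\<close> is \<open>\<bottom>\<close>.
  No trialgebra identity is imposed: the algebras below are given by their multiplication
  tables, and not all tables satisfy the associative trialgebra axioms.  For instance
  \<open>(e2 \<stileturn> e2) \<turnstile> e2 = 0\<close> but \<open>e2 \<turnstile> (e2 \<turnstile> e2) = e2\<close> in \<open>trias2_5\<close>.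
\<close>

record 'v triple_alg =
  lprod :: "'v \<Rightarrow> 'v \<Rightarrow> 'v"
  rprod :: "'v \<Rightarrow> 'v \<Rightarrow> 'v"
  mprod :: "'v \<Rightarrow> 'v \<Rightarrow> 'v"

definition centroid ::
  "('a::field ^ 'n) triple_alg \<Rightarrow> ('a ^ 'n \<Rightarrow> 'a ^ 'n) set" where
  "centroid T = {\<psi>. Vector_Spaces.linear (*s) (*s) \<psi> \<and>
     (\<forall>p \<in> {lprod T, rprod T, mprod T}. \<forall>x y.
        \<psi> (p x y) = p x (\<psi> y) \<and> \<psi> (p x y) = p (\<psi> x) y)}"

text \<open>
  The space of all maps into a coordinate space, with pointwise operations (addition is
  that of \<open>Function_Algebras\<close>), and the dimension of its subspaces.
\<close>

definition map_scale :: "'a::field \<Rightarrow> ('b \<Rightarrow> 'a ^ 'n) \<Rightarrow> ('b \<Rightarrow> 'a ^ 'n)" where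
  "map_scale c \<psi> = (\<lambda>x. c *s \<psi> x)"

lemma vector_space_map_scale: "vector_space map_scale"
  by unfold_locales
     (auto simp: map_scale_def fun_eq_iff vec.scale_right_distrib vec.scale_left_distrib)

definition map_dim :: "('b \<Rightarrow> 'a::field ^ 'n) set \<Rightarrow> nat" where
  "map_dim = vector_space.dim map_scale"

abbreviation e1 :: "complex ^ 2" where "e1 \<equiv> axis 1 1"
abbreviation e2 :: "complex ^ 2" where "e2 \<equiv> axis 2 1"

text \<open>
  The bilinear product determined by its values on \<open>(e1,e1)\<close>, \<open>(e1,e2)\<close>, \<open>(e2,e1)\<close>,
  \<open>(e2,e2)\<close>, in this order.
\<close>

definition bilin ::
  "complex ^ 2 \<Rightarrow> complex ^ 2 \<Rightarrow> complex ^ 2 \<Rightarrow> complex ^ 2 \<Rightarrow>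
   complex ^ 2 \<Rightarrow> complex ^ 2 \<Rightarrow> complex ^ 2" where
  "bilin p11 p12 p21 p22 x y =
     (x$1 * y$1) *s p11 + (x$1 * y$2) *s p12 + (x$2 * y$1) *s p21 + (x$2 * y$2) *s p22"

definition trias2_1 :: "complex \<Rightarrow> complex \<Rightarrow> (complex ^ 2) triple_alg" where
  "trias2_1 a b = \<lparr>
     lprod = bilin 0 (a *s e1) 0 (a *s e2),
     rprod = bilin 0 0 (a *s e1) (a *s e2),
     mprod = bilin (b *s e1) (b *s e1 + a *s e2) 0 0\<rparr>"

definition trias2_2 :: "complex \<Rightarrow> (complex ^ 2) triple_alg" where
  "trias2_2 a = \<lparr>
     lprod = bilin e1 0 e2 0,
     rprod = bilin e1 e2 0 0,
     mprod = bilin 0 (e1 + a *s e2) 0 e2\<rparr>"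

definition trias2_3 :: "(complex ^ 2) triple_alg" where
  "trias2_3 = \<lparr>
     lprod = bilin 0 0 0 e2,
     rprod = bilin 0 0 e1 e2,
     mprod = bilin 0 0 e1 e2\<rparr>"

definition trias2_4 :: "(complex ^ 2) triple_alg" where
  "trias2_4 = \<lparr>
     lprod = bilin 0 e1 0 e2,
     rprod = bilin 0 0 0 (e1 + e2),
     mprod = bilin 0 0 0 (e1 + e2)\<rparr>"

definition trias2_5 :: "(complex ^ 2) triple_alg" where
  "trias2_5 = \<lparr>
     lprod = bilin e1 0 0 0,
     rprod = bilin 0 0 e1 e2,
     mprod = bilin e1 e2 0 0\<rparr>"

definition trias2_6 :: "(complex ^ 2) triple_alg" where
  "trias2_6 = \<lparr>
     lprod = bilin e1 0 e2 0,
     rprod = bilin e1 0 0 0,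
     mprod = bilin e1 0 0 0\<rparr>"

definition trias2_7 :: "(complex ^ 2) triple_alg" where
  "trias2_7 = \<lparr>
     lprod = bilin e1 0 e2 0,
     rprod = bilin e1 e2 0 0,
     mprod = bilin e1 e2 0 0\<rparr>"

definition trias2_8 :: "complex \<Rightarrow> complex \<Rightarrow> (complex ^ 2) triple_alg" where
  "trias2_8 a b = \<lparr>
     lprod = bilin (a *s e1) 0 (a *s e2) 0,
     rprod = bilin (a *s e1) (a *s e2) 0 0,
     mprod = bilin (a *s e1 + b *s e2) 0 0 0\<rparr>"

text \<open>
  The family as a function of the index.  The two parameters are ignored by those members
  whose tables do not mention them; the value at an index outside 1 to 8 is
  irrelevant.  At degenerate parameters the centroid is larger than the scalars: all
  products of \<open>trias2_1 0 0\<close> vanish, and the only possibly nonzero product of basis vectors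
  in \<open>trias2_8 0 b\<close> is \<open>e1 \<bottom> e1 = b e2\<close>, so that \<open>e1 \<mapsto> e2, e2 \<mapsto> 0\<close> is in the centroid.
\<close>

definition trias2 :: "nat \<Rightarrow> complex \<Rightarrow> complex \<Rightarrow> (complex ^ 2) triple_alg" where
  "trias2 m a b =
     (if m = 1 then trias2_1 a b
      else if m = 2 then trias2_2 a
      else if m = 3 then trias2_3
      else if m = 4 then trias2_4
      else if m = 5 then trias2_5
      else if m = 6 then trias2_6
      else if m = 7 then trias2_7
      else trias2_8 a b)"

end

theory Submission
  imports Defs
begin

text \<open>
  The homotheties \<open>x \<mapsto> c x\<close> lie in the centroid of every algebra whose products are
  bilinear, so the content is that nothing else does.  For each table it suffices to look
  at a single product.  Except for \<open>trias2_1 0 b\<close>, and given \<open>a \<noteq> 0\<close> in \<open>trias2_8 a b\<close>, every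
  algebra of the family has a product that only rescales one of its arguments: \<open>p x y = f y x\<close> or \<open>p x y = f x y\<close> with a
  functional \<open>f \<noteq> 0\<close>.  If \<open>f y\<^sub>0 \<noteq> 0\<close>, then \<open>f y\<^sub>0 \<psi> x = \<psi> (p x y\<^sub>0) = p x (\<psi> y\<^sub>0) = f (\<psi> y\<^sub>0) x\<close>
  makes \<open>\<psi>\<close> the homothety of ratio \<open>f (\<psi> y\<^sub>0) / f y\<^sub>0\<close>
  (\<open>centroid_homothety_if_scales_left\<close>, \<open>centroid_homothety_if_scales_right\<close>).

  In \<open>trias2_1 0 b\<close> with \<open>b \<noteq> 0\<close> the only nonzero product has rank one,
  \<open>x \<bottom> y = b x\<^sub>1 (y\<^sub>1 + y\<^sub>2) e\<^sub>1\<close>.  Moving \<open>\<psi>\<close> across it shows that the two functionals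
  \<open>x\<^sub>1\<close> and \<open>y\<^sub>1 + y\<^sub>2\<close> are eigenvectors of composition with \<open>\<psi>\<close> for a common eigenvalue; since
  they are coordinates on the plane, \<open>\<psi>\<close> is again a homothety
  (\<open>centroid_homothety_if_rank_one\<close>).

  The homotheties form the line spanned by the identity map, which gives the dimension.
\<close>

lemma centroid_moves_across:
  assumes "\<psi> \<in> centroid T" and "p \<in> {lprod T, rprod T, mprod T}"
  shows "p x (\<psi> y) = \<psi> (p x y)" and "p (\<psi> x) y = \<psi> (p x y)"
proof -
  have "\<psi> (p x y) = p x (\<psi> y) \<and> \<psi> (p x y) = p (\<psi> x) y"
    using assms unfolding centroid_def by blast
  then show "p x (\<psi> y) = \<psi> (p x y)" and "p (\<psi> x) y = \<psi> (p x y)" by metis+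
qed

lemma centroid_homothety_if_scales_left:
  fixes T :: "('a::field ^ 'n) triple_alg"
  assumes "\<psi> \<in> centroid T" and "p \<in> {lprod T, rprod T, mprod T}"
    and p: "\<And>x y. p x y = f y *s x" and "f y\<^sub>0 \<noteq> 0"
  shows "\<psi> \<in> range (*s)"
proof -
  have lin: "Vector_Spaces.linear (*s) (*s) \<psi>"
    using assms(1) by (simp add: centroid_def)
  have "f y\<^sub>0 *s \<psi> x = f (\<psi> y\<^sub>0) *s x" for x
    using centroid_moves_across(1)[OF assms(1,2), of x y\<^sub>0]
    by (simp add: p vec.linear_scale[OF lin])
  then have "\<psi> x = (f (\<psi> y\<^sub>0) / f y\<^sub>0) *s x" for x
    using \<open>f y\<^sub>0 \<noteq> 0\<close>
    by (metis (no_types, lifting) divide_inverse mult.commute right_inverse vec.scale_one vec.scale_scale)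
  then show ?thesis by auto
qed

lemma centroid_homothety_if_scales_right:
  fixes T :: "('a::field ^ 'n) triple_alg"
  assumes "\<psi> \<in> centroid T" and "p \<in> {lprod T, rprod T, mprod T}"
    and p: "\<And>x y. p x y = f x *s y" and "f x\<^sub>0 \<noteq> 0"
  shows "\<psi> \<in> range (*s)"
proof -
  have lin: "Vector_Spaces.linear (*s) (*s) \<psi>"
    using assms(1) by (simp add: centroid_def)
  have "f x\<^sub>0 *s \<psi> y = f (\<psi> x\<^sub>0) *s y" for y
    using centroid_moves_across(2)[OF assms(1,2), of x\<^sub>0 y]
    by (simp add: p vec.linear_scale[OF lin])
  then have "\<psi> y = (f (\<psi> x\<^sub>0) / f x\<^sub>0) *s y" for y
    using \<open>f x\<^sub>0 \<noteq> 0\<close>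
    by (metis (no_types, lifting) divide_inverse mult.commute right_inverse vec.scale_one vec.scale_scale)
  then show ?thesis by auto
qed

text \<open>
  Comparing \<open>p (\<psi> x) y\<close> with \<open>p x (\<psi> y)\<close> gives \<open>f (\<psi> x) g y = f x g (\<psi> y)\<close>.  Fixing \<open>y\<close> or \<open>x\<close>
  outside the kernel of its functional makes \<open>f\<close> and \<open>g\<close> scale under \<open>\<psi>\<close> by the same ratio,
  and the last hypothesis says that the values of \<open>f\<close> and \<open>g\<close> determine a vector.
\<close>

lemma centroid_homothety_if_rank_one:
  fixes T :: "('a::field ^ 'n) triple_alg"
  assumes "\<psi> \<in> centroid T" and "p \<in> {lprod T, rprod T, mprod T}"
    and p: "\<And>x y. p x y = (f x * g y) *s u" and "u \<noteq> 0"
    and "f x\<^sub>0 \<noteq> 0" and "g y\<^sub>0 \<noteq> 0"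
    and f_scale: "\<And>c x. f (c *s x) = c * f x" and g_scale: "\<And>c x. g (c *s x) = c * g x"
    and separating: "\<And>x y. f x = f y \<Longrightarrow> g x = g y \<Longrightarrow> x = y"
  shows "\<psi> \<in> range (*s)"
proof -
  have swap: "f (\<psi> x) * g y = f x * g (\<psi> y)" for x y
    using centroid_moves_across[OF assms(1,2), of x y] \<open>u \<noteq> 0\<close>
    by (metis p vec.scale_right_imp_eq)
  define c where "c = g (\<psi> y\<^sub>0) / g y\<^sub>0"
  have f: "f (\<psi> x) = c * f x" for x
    using swap[of x y\<^sub>0] \<open>g y\<^sub>0 \<noteq> 0\<close> by (simp add: c_def field_simps)
  have "g (\<psi> y) = c * g y" for y
    using swap[of x\<^sub>0 y] f[of x\<^sub>0] \<open>f x\<^sub>0 \<noteq> 0\<close> by simp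
  with f have "\<psi> x = c *s x" for x
    by (intro separating) (simp_all add: f_scale g_scale)
  then show ?thesis by auto
qed

lemma homothety_in_centroid:
  fixes T :: "('a::field ^ 'n) triple_alg"
  assumes "\<And>p c x y. p \<in> {lprod T, rprod T, mprod T} \<Longrightarrow> p (c *s x) y = c *s p x y"
    and "\<And>p c x y. p \<in> {lprod T, rprod T, mprod T} \<Longrightarrow> p x (c *s y) = c *s p x y"
  shows "range (*s) \<subseteq> centroid T"
proof -
  have "(*s) c \<in> centroid T" for c
    unfolding centroid_def mem_Collect_eq
  proof (intro conjI ballI allI)
    show "Vector_Spaces.linear (*s) (*s) ((*s) c :: 'a ^ 'n \<Rightarrow> _)"
      by (rule vec.linear_scale_self)
  qed (simp_all only: assms)
  then show ?thesis by blast
qed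

lemma bilin_scale:
  "bilin p11 p12 p21 p22 (c *s x) y = c *s bilin p11 p12 p21 p22 x y"
  "bilin p11 p12 p21 p22 x (c *s y) = c *s bilin p11 p12 p21 p22 x y"
  by (simp_all add: bilin_def vec.scale_right_distrib mult_ac)

lemmas trias2_defs = trias2_def trias2_1_def trias2_2_def trias2_3_def trias2_4_def
  trias2_5_def trias2_6_def trias2_7_def trias2_8_def

lemma homothety_in_centroid_trias2: "range (*s) \<subseteq> centroid (trias2 m a b)"
  by (rule homothety_in_centroid) (auto simp: trias2_defs bilin_scale)

text \<open>
  These two patterns of structure constants are how a product that only rescales one
  argument shows up in a multiplication table.
\<close>

lemma bilin_scales_left: "bilin (a *s e1) (b *s e1) (a *s e2) (b *s e2) x y = (a * y$1 + b * y$2) *s x"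
  by (simp add: bilin_def vec_eq_iff forall_2 axis_def algebra_simps)

lemma bilin_scales_right: "bilin (a *s e1) (a *s e2) (b *s e1) (b *s e2) x y = (a * x$1 + b * x$2) *s y"
  by (simp add: bilin_def vec_eq_iff forall_2 axis_def algebra_simps)

lemma centroid_trias2_1_degenerate:
  assumes "\<psi> \<in> centroid (trias2_1 0 b)" and "b \<noteq> 0"
  shows "\<psi> \<in> range (*s)"
proof (rule centroid_homothety_if_rank_one[OF assms(1),
      where p = "mprod (trias2_1 0 b)" and f = "\<lambda>x. b * x$1" and g = "\<lambda>y. y$1 + y$2"
        and u = e1 and x\<^sub>0 = e1 and y\<^sub>0 = e1])
  show "mprod (trias2_1 0 b) x y = (b * x$1 * (y$1 + y$2)) *s e1" for x y
    by (simp add: trias2_1_def bilin_def vec_eq_iff algebra_simps)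
qed (use \<open>b \<noteq> 0\<close> in \<open>auto simp: vec_eq_iff forall_2 axis_def algebra_simps\<close>)

lemma centroid_trias2_subset:
  assumes "1 \<le> m" and "m \<le> 8"
    and nondegenerate: "m = 1 \<Longrightarrow> a \<noteq> 0 \<or> b \<noteq> 0" "m = 8 \<Longrightarrow> a \<noteq> 0"
  shows "centroid (trias2 m a b) \<subseteq> range (*s)"
proof
  fix \<psi> assume \<psi>: "\<psi> \<in> centroid (trias2 m a b)"
  let ?T = "trias2 m a b"
  have left: "\<psi> \<in> range (*s)"
    if "lprod ?T = bilin (c *s e1) (d *s e1) (c *s e2) (d *s e2)" and "c \<noteq> 0 \<or> d \<noteq> 0" for c d
  proof (rule centroid_homothety_if_scales_left[OF \<psi>])
    show "lprod ?T \<in> {lprod ?T, rprod ?T, mprod ?T}" by simp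
    show "lprod ?T x y = (c * y$1 + d * y$2) *s x" for x y
      by (simp only: that(1) bilin_scales_left)
    show "c * (if c = 0 then e2 else e1)$1 + d * (if c = 0 then e2 else e1)$2 \<noteq> 0"
      using that(2) by (auto simp: axis_def)
  qed
  have right: "\<psi> \<in> range (*s)"
    if "rprod ?T = bilin (c *s e1) (c *s e2) (d *s e1) (d *s e2)" and "c \<noteq> 0 \<or> d \<noteq> 0" for c d
  proof (rule centroid_homothety_if_scales_right[OF \<psi>])
    show "rprod ?T \<in> {lprod ?T, rprod ?T, mprod ?T}" by simp
    show "rprod ?T x y = (c * x$1 + d * x$2) *s y" for x y
      by (simp only: that(1) bilin_scales_right)
    show "c * (if c = 0 then e2 else e1)$1 + d * (if c = 0 then e2 else e1)$2 \<noteq> 0"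
      using that(2) by (auto simp: axis_def)
  qed
  from \<open>1 \<le> m\<close> \<open>m \<le> 8\<close>
  consider "m = 1" "a = 0" | "m = 1" "a \<noteq> 0" | "m = 4" | "m \<in> {3, 5}" | "m \<in> {2, 6, 7}" | "m = 8"
    by fastforce
  then show "\<psi> \<in> range (*s)"
  proof cases
    case 1
    then show ?thesis
      using \<psi> nondegenerate(1) centroid_trias2_1_degenerate by (simp add: trias2_def)
  next
    case 2
    then show ?thesis by (intro left[of 0 a]) (auto simp: trias2_defs)
  next
    case 3
    then show ?thesis by (intro left[of 0 1]) (auto simp: trias2_defs)
  next
    case 4
    then show ?thesis by (intro right[of 0 1]) (auto simp: trias2_defs)
  next
    case 5
    then show ?thesis by (intro left[of 1 0]) (auto simp: trias2_defs)
  next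
    case 6
    then show ?thesis using nondegenerate(2) by (intro left[of a 0]) (auto simp: trias2_defs)
  qed
qed

lemma matrix_homothety_iff:
  fixes \<psi> :: "complex ^ 2 \<Rightarrow> complex ^ 2"
  shows "(Vector_Spaces.linear (*s) (*s) \<psi> \<and>
      (\<exists>c. matrix \<psi> = vector [vector [c, 0], vector [0, c]])) \<longleftrightarrow> \<psi> \<in> range (*s)"
proof
  have M: "vector [vector [c, 0], vector [0, c]] *v x = c *s x" for c :: complex and x :: "complex ^ 2"
    by (simp add: vec_eq_iff forall_2 matrix_vector_mult_def sum_2)
  assume "Vector_Spaces.linear (*s) (*s) \<psi> \<and>
      (\<exists>c. matrix \<psi> = vector [vector [c, 0], vector [0, c]])"
  then show "\<psi> \<in> range (*s)"
    using matrix_works[of \<psi>] by (metis M ext rangeI)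
next
  assume "\<psi> \<in> range (*s)"
  then obtain c where "\<psi> = (*s) c" by blast
  moreover have "matrix ((*s) c) = (vector [vector [c, 0], vector [0, c]] :: complex ^ 2 ^ 2)"
    by (simp add: vec_eq_iff forall_2 matrix_def axis_def)
  ultimately show "Vector_Spaces.linear (*s) (*s) \<psi> \<and>
      (\<exists>c. matrix \<psi> = vector [vector [c, 0], vector [0, c]])"
    by (auto intro: vec.linear_scale_self)
qed

lemma map_dim_homotheties: "map_dim (range ((*s) :: 'a::field \<Rightarrow> 'a ^ 'n \<Rightarrow> 'a ^ 'n)) = 1"
proof -
  interpret maps: vector_space "map_scale :: 'a \<Rightarrow> ('a ^ 'n \<Rightarrow> 'a ^ 'n) \<Rightarrow> _"
    by (rule vector_space_map_scale)
  have "range ((*s) :: 'a \<Rightarrow> 'a ^ 'n \<Rightarrow> 'a ^ 'n) = maps.span {id}"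
    by (simp add: maps.span_singleton map_scale_def id_def)
  moreover have "(id :: 'a ^ 'n \<Rightarrow> 'a ^ 'n) \<noteq> 0"
  proof
    assume "(id :: 'a ^ 'n \<Rightarrow> 'a ^ 'n) = 0"
    then have "(1 :: 'a ^ 'n) = 0" by (metis id_apply zero_fun_apply)
    then show False by simp
  qed
  then have "maps.dim {id :: 'a ^ 'n \<Rightarrow> 'a ^ 'n} = 1"
    by (subst maps.dim_eq_card_independent) simp_all
  ultimately show ?thesis
    by (simp add: map_dim_def maps.dim_span)
qed

theorem theorem5p8:
  fixes m :: nat and a b :: complex
  assumes "1 \<le> m" and "m \<le> 8"
    and "m = 1 \<Longrightarrow> a \<noteq> 0 \<or> b \<noteq> 0"
    and "m = 8 \<Longrightarrow> a \<noteq> 0"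
  shows "centroid (trias2 m a b) =
           {\<psi>. Vector_Spaces.linear (*s) (*s) \<psi> \<and>
                (\<exists>a11::complex. matrix \<psi> = vector [vector [a11, 0], vector [0, a11]])}
         \<and> map_dim (centroid (trias2 m a b)) = 1"
proof -
  have "centroid (trias2 m a b) = range (*s)"
    using centroid_trias2_subset[OF assms] homothety_in_centroid_trias2 by blast
  then show ?thesis
    by (simp add: matrix_homothety_iff map_dim_homotheties)
qed

end
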